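(* Let $\mathcal{H}$ be a real Hilbert space, let $B\colon\mathcal{H}\to\mathcal{H}$, let $q\in\mathcal{H}$, let $\theta>0$, let $\sigma\in\mathbb{R}$, let $\kappa>0$ and let $\beta>0$. Then the following assertions hold. (i) $B$ is $\kappa$-Lipschitz continuous if and only if $(B_{-q})^{(\theta,0)}$ is $\kappa\theta$-Lipschitz continuous. Consequently, if $B$ is $\kappa$-Lipschitz continuous, then $(B_{-q})^{(\theta,\sigma)}$ is $(\kappa\theta+|\sigma|)$-Lipschitz continuous. (ii) $B$ is locally Lipschitz continuous if and only if $(B_{-q})^{(\theta,\sigma)}$ is locally Lipschitz continuous. (iii) $B$ is $\beta$-cocoercive if and only if $(B_{-q})^{(\theta,0)}$ is $\frac{\beta}{\theta}$-cocoercive. Consequently, if $B$ is $\beta$-cocoercive and $\sigma>0$, then $(B_{-q})^{(\theta,\sigma)}$ is $\mu$-cocoercive with $$\mu:=\left(\frac{\theta}{\beta}+\sigma\right)^{-1}.$$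
   Context: For an operator $B$ on $\mathcal{H}$, a point $q\in\mathcal{H}$, $\theta>0$ and $\sigma\in\mathbb{R}$, the $(\theta,\sigma)$-strengthening of $B$ is $B^{(\theta,\sigma)}:=B\circ(\theta\,\mathrm{Id})+\sigma\,\mathrm{Id}$; the inner $w$-perturbation of $B$ is $B_w(x):=B(x-w)$. Hence $(B_{-q})^{(\theta,\sigma)}(x)=B(\theta x+q)+\sigma x$. A map $T\colon\mathcal{H}\to\mathcal{H}$ is $\kappa$-Lipschitz continuous if $\|T(x)-T(y)\|\le\kappa\|x-y\|$ for all $x,y\in\mathcal{H}$; locally Lipschitz continuous if for every $x_0\in\mathcal{H}$ there exist $\delta,\kappa>0$ such that $\|T(y)-T(z)\|\le\kappa\|y-z\|$ for all $y,z$ in the closed ball of centre $x_0$ and radius $\delta$; and $\beta$-cocoercive ($\beta>0$) if $\langle x-y,T(x)-T(y)\rangle\ge\beta\|T(x)-T(y)\|^2$ for all $x,y\in\mathcal{H}$. *)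

theory Defs
  imports "HOL-Analysis.Analysis"
begin

definition strengthening :: "real \<Rightarrow> real \<Rightarrow> ('a \<Rightarrow> 'a) \<Rightarrow> 'a \<Rightarrow> 'a::real_vector" where
  "strengthening \<theta> \<sigma> B = (\<lambda>x. (B \<circ> scaleR \<theta>) x + \<sigma> *\<^sub>R x)"

definition inner_perturbation :: "'a::ab_group_add \<Rightarrow> ('a \<Rightarrow> 'b) \<Rightarrow> 'a \<Rightarrow> 'b" where
  "inner_perturbation w B = (\<lambda>x. B (x - w))"

(* The library's local_lipschitz concerns families of maps indexed by a parameter
   and is local in that parameter too; this is the notion for a single map. *)
definition locally_lipschitz :: "('a::metric_space \<Rightarrow> 'b::metric_space) \<Rightarrow> bool" where
  "locally_lipschitz T \<longleftrightarrow>
     (\<forall>x0. \<exists>\<delta>>0. \<exists>\<kappa>>0. \<kappa>-lipschitz_on (cball x0 \<delta>) T)"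

definition cocoercive :: "real \<Rightarrow> ('a::real_inner \<Rightarrow> 'a) \<Rightarrow> bool" where
  "cocoercive \<beta> T \<longleftrightarrow>
     0 < \<beta> \<and> (\<forall>x y. (x - y) \<bullet> (T x - T y) \<ge> \<beta> * (norm (T x - T y))\<^sup>2)"

end

theory Submission
  imports Defs
begin

text \<open>
  The strengthened map is \<open>B\<close> precomposed with an affine bijection, plus a multiple of the identity,
  and \<open>B\<close> is recovered from it by an operation of the same kind; this gives the equivalences.
  For the last claim, \<open>\<sigma> Id\<close> is \<open>1/\<sigma>\<close>-cocoercive, and cocoercivity constants of a sum combine
  like parallel resistances.
\<close>

lemma strengthening_inner_perturbation_apply:
  "strengthening \<theta> \<sigma> (inner_perturbation w B) x = B (\<theta> *\<^sub>R x - w) + \<sigma> *\<^sub>R x"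
  by (simp add: strengthening_def inner_perturbation_def)

text \<open>Splitting off the linear term lets a sum rule reduce arbitrary \<open>\<sigma>\<close>
  to the case \<open>\<sigma> = 0\<close>.\<close>

lemma strengthening_conv_add:
  "strengthening \<theta> \<sigma> B = (\<lambda>x. strengthening \<theta> 0 B x + \<sigma> *\<^sub>R x)"
  by (simp add: strengthening_def)

text \<open>Substituting the inverse of the affine map x \<mapsto> \<theta> x - w leaves B y plus
  (\<sigma> / \<theta>)(y + w), and the correction term cancels the latter. The converse directions
  of the Lipschitz equivalences rest on this.\<close>

lemma strengthening_inner_perturbation_inverse:
  assumes "\<theta> \<noteq> 0"
  shows "(\<lambda>y. strengthening \<theta> \<sigma> (inner_perturbation w B) ((1 / \<theta>) *\<^sub>R (y + w))
            + (- \<sigma> / \<theta>) *\<^sub>R (y + w)) = B"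
  using assms by (simp add: strengthening_inner_perturbation_apply)

text \<open>The three forms are the inner map, its inverse together with the correction term, and
  the added multiple of the identity. The absolute value is needed because the factors
  \<open>\<sigma>\<close> and \<open>- \<sigma> / \<theta>\<close> may be negative.\<close>

lemma lipschitz_on_affine:
  fixes b :: "'a::real_normed_vector"
  shows "\<bar>c\<bar>-lipschitz_on U (\<lambda>x. c *\<^sub>R x - b)"
    and "\<bar>c\<bar>-lipschitz_on U (\<lambda>x. c *\<^sub>R (x + b))"
    and "\<bar>c\<bar>-lipschitz_on U (\<lambda>x::'a. c *\<^sub>R x)"
proof -
  have "norm (c *\<^sub>R x - c *\<^sub>R y) = \<bar>c\<bar> * norm (x - y)" for x y :: 'a
    by (metis norm_scaleR scaleR_diff_right)
  then show "\<bar>c\<bar>-lipschitz_on U (\<lambda>x. c *\<^sub>R x - b)"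
    and "\<bar>c\<bar>-lipschitz_on U (\<lambda>x. c *\<^sub>R (x + b))"
    and "\<bar>c\<bar>-lipschitz_on U (\<lambda>x::'a. c *\<^sub>R x)"
    by (auto intro!: lipschitz_onI simp: dist_norm scaleR_add_right)
qed

lemma lipschitz_on_strengthening:
  fixes B :: "'a::real_normed_vector \<Rightarrow> 'a"
  assumes "\<kappa>-lipschitz_on UNIV B" and "\<theta> \<ge> 0"
  shows "(\<kappa> * \<theta> + \<bar>\<sigma>\<bar>)-lipschitz_on UNIV (strengthening \<theta> \<sigma> (inner_perturbation w B))"
proof -
  have "\<theta>-lipschitz_on UNIV (\<lambda>x. \<theta> *\<^sub>R x - w)"
    using assms(2) lipschitz_on_affine(1)[of \<theta> UNIV w] by simp
  then have "(\<kappa> * \<theta>)-lipschitz_on UNIV (\<lambda>x. B (\<theta> *\<^sub>R x - w))"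
    using assms(1) by (rule lipschitz_on_compose2[OF _ lipschitz_on_subset]) simp
  then show ?thesis
    unfolding strengthening_inner_perturbation_apply[abs_def]
    by (intro lipschitz_on_add lipschitz_on_affine(3))
qed

text \<open>Rescaling by \<open>\<theta>\<close> and then by 1 / \<theta> loses nothing, so the
  constant \<open>\<kappa>\<close> is recovered exactly. For nonzero \<open>\<sigma>\<close> the
  same argument would recover only a larger constant, as the triangle inequality adds |\<sigma>| /
  \<theta> for the correction term.\<close>

lemma lipschitz_on_strengthening_iff:
  fixes B :: "'a::real_normed_vector \<Rightarrow> 'a"
  assumes "\<theta> > 0"
  shows "\<kappa>-lipschitz_on UNIV B
    \<longleftrightarrow> (\<kappa> * \<theta>)-lipschitz_on UNIV (strengthening \<theta> 0 (inner_perturbation w B))"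
proof
  show "(\<kappa> * \<theta>)-lipschitz_on UNIV (strengthening \<theta> 0 (inner_perturbation w B))"
    if "\<kappa>-lipschitz_on UNIV B"
    using lipschitz_on_strengthening[OF that, of \<theta> 0] assms by simp
  let ?C = "strengthening \<theta> 0 (inner_perturbation w B)"
  assume "(\<kappa> * \<theta>)-lipschitz_on UNIV ?C"
  then have "(\<kappa> * \<theta> * \<bar>1 / \<theta>\<bar>)-lipschitz_on UNIV (\<lambda>y. ?C ((1 / \<theta>) *\<^sub>R (y + w)))"
    by (rule lipschitz_on_compose2[OF lipschitz_on_affine(2) lipschitz_on_subset]) simp
  then have "\<kappa>-lipschitz_on UNIV (\<lambda>y. ?C ((1 / \<theta>) *\<^sub>R (y + w)))"
    using assms by simp
  moreover have B: "B = (\<lambda>y. ?C ((1 / \<theta>) *\<^sub>R (y + w)))"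
    using assms strengthening_inner_perturbation_inverse[of \<theta> 0 w B] by simp
  ultimately show "\<kappa>-lipschitz_on UNIV B"
    by (subst B)
qed

lemma lipschitz_imp_locally_lipschitz:
  assumes "K-lipschitz_on UNIV f"
  shows "locally_lipschitz f"
  unfolding locally_lipschitz_def
proof
  fix x0
  \<comment> \<open>The radius 1 is arbitrary; K is raised to K + 1 because the local constant must
    be positive and K may be 0.\<close>
  have "(K + 1)-lipschitz_on (cball x0 1) f"
    using assms by (rule lipschitz_on_mono) auto
  moreover have "K + 1 > 0"
    using lipschitz_on_nonneg[OF assms] by simp
  ultimately show "\<exists>\<delta>>0. \<exists>\<kappa>>0. \<kappa>-lipschitz_on (cball x0 \<delta>) f"
    using zero_less_one by blast
qed

lemma locally_lipschitz_add:
  fixes f g :: "'a::metric_space \<Rightarrow> 'b::real_normed_vector"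
  assumes "locally_lipschitz f" and "locally_lipschitz g"
  shows "locally_lipschitz (\<lambda>x. f x + g x)"
  unfolding locally_lipschitz_def
proof
  fix x0
  obtain d K where f: "d > 0" "K > 0" "K-lipschitz_on (cball x0 d) f"
    using assms(1) unfolding locally_lipschitz_def by blast
  obtain e L where g: "e > 0" "L > 0" "L-lipschitz_on (cball x0 e) g"
    using assms(2) unfolding locally_lipschitz_def by blast
  have "(K + L)-lipschitz_on (cball x0 (min d e)) (\<lambda>x. f x + g x)"
    using f(3) g(3) by (intro lipschitz_on_add) (auto intro: lipschitz_on_subset)
  moreover have "min d e > 0" "K + L > 0"
    using f g by auto
  ultimately show "\<exists>\<delta>>0. \<exists>\<kappa>>0. \<kappa>-lipschitz_on (cball x0 \<delta>) (\<lambda>x. f x + g x)"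
    by blast
qed

lemma locally_lipschitz_compose_lipschitz:
  assumes f: "locally_lipschitz f" and g: "L-lipschitz_on UNIV g"
  shows "locally_lipschitz (\<lambda>x. f (g x))"
  unfolding locally_lipschitz_def
proof
  fix x0
  obtain d K where dK: "d > 0" "K > 0" "K-lipschitz_on (cball (g x0) d) f"
    using f unfolding locally_lipschitz_def by blast
  \<comment> \<open>A strictly positive Lipschitz constant of g keeps the radius d / M meaningful
    and the product K * M positive even if L = 0.\<close>
  define M where "M = L + 1"
  have M: "M > 0" "M-lipschitz_on UNIV g"
    using lipschitz_on_nonneg[OF g] g by (auto simp: M_def intro: lipschitz_on_le)
  \<comment> \<open>g stretches distances by at most M, so this radius keeps the image where the
    bound on f is available.\<close>
  have "g ` cball x0 (d / M) \<subseteq> cball (g x0) d"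
  proof (intro image_subsetI)
    fix x
    assume "x \<in> cball x0 (d / M)"
    then have "M * dist x0 x \<le> d"
      using M(1) by (simp add: field_simps)
    then show "g x \<in> cball (g x0) d"
      using lipschitz_onD[OF M(2), of x0 x] by simp
  qed
  then have "(K * M)-lipschitz_on (cball x0 (d / M)) (\<lambda>x. f (g x))"
    using M(2) dK(3) by (intro lipschitz_on_compose2) (auto intro: lipschitz_on_subset)
  moreover have "d / M > 0" "K * M > 0"
    using dK M by auto
  ultimately show "\<exists>\<delta>>0. \<exists>\<kappa>>0. \<kappa>-lipschitz_on (cball x0 \<delta>) (\<lambda>x. f (g x))"
    by blast
qed

text \<open>Local constants need not be tracked, so the correction term costs nothing and the
  equivalence holds for every \<open>\<sigma>\<close>.\<close>

lemma locally_lipschitz_strengthening_iff: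
  fixes B :: "'a::real_normed_vector \<Rightarrow> 'a"
  assumes "\<theta> \<noteq> 0"
  shows "locally_lipschitz B
    \<longleftrightarrow> locally_lipschitz (strengthening \<theta> \<sigma> (inner_perturbation w B))"
proof
  assume "locally_lipschitz B"
  then have "locally_lipschitz (\<lambda>x. B (\<theta> *\<^sub>R x - w))"
    by (rule locally_lipschitz_compose_lipschitz[OF _ lipschitz_on_affine(1)])
  then show "locally_lipschitz (strengthening \<theta> \<sigma> (inner_perturbation w B))"
    unfolding strengthening_inner_perturbation_apply[abs_def]
    by (intro locally_lipschitz_add lipschitz_imp_locally_lipschitz[OF lipschitz_on_affine(3)])
next
  let ?C = "strengthening \<theta> \<sigma> (inner_perturbation w B)"
  assume "locally_lipschitz ?C"
  then have "locally_lipschitz (\<lambda>y. ?C ((1 / \<theta>) *\<^sub>R (y + w)) + (- \<sigma> / \<theta>) *\<^sub>R (y + w))"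
    by (intro locally_lipschitz_add lipschitz_imp_locally_lipschitz[OF lipschitz_on_affine(2)]
        locally_lipschitz_compose_lipschitz[of ?C, OF _ lipschitz_on_affine(2)])
  then show "locally_lipschitz B"
    by (simp only: strengthening_inner_perturbation_inverse[OF assms])
qed

text \<open>The affine change of variables multiplies x - y by \<open>\<theta>\<close> and leaves
  the differences of values alone; dividing the inequality by \<open>\<theta>\<close> turns
  \<open>\<beta>\<close> into \<open>\<beta> / \<theta>\<close>.\<close>

lemma cocoercive_strengthening_iff:
  fixes B :: "'a::real_inner \<Rightarrow> 'a"
  assumes "\<theta> > 0"
  shows "cocoercive \<beta> B
    \<longleftrightarrow> cocoercive (\<beta> / \<theta>) (strengthening \<theta> 0 (inner_perturbation w B))"
proof -
  let ?g = "\<lambda>x. \<theta> *\<^sub>R x - w"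
  let ?P = "\<lambda>x y. \<beta> * (norm (B x - B y))\<^sup>2 \<le> (x - y) \<bullet> (B x - B y)"
  \<comment> \<open>Surjectivity lets the quantifiers over all points run over images under
    \<open>?g\<close>, which yields both directions at once.\<close>
  have "surj ?g"
    using assms by (intro surjI[of _ "\<lambda>y. (1 / \<theta>) *\<^sub>R (y + w)"]) simp
  then have "(\<forall>x y. ?P x y) \<longleftrightarrow> (\<forall>x\<in>range ?g. \<forall>y\<in>range ?g. ?P x y)"
    by (simp only: ball_UNIV)
  also have "\<dots> \<longleftrightarrow> (\<forall>x y. ?P (?g x) (?g y))"
    by (simp only: ball_simps ball_UNIV)
  also have "\<dots> \<longleftrightarrow> (\<forall>x y. \<beta> / \<theta> * (norm (B (?g x) - B (?g y)))\<^sup>2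
      \<le> (x - y) \<bullet> (B (?g x) - B (?g y)))"
  proof -
    have "?g x - ?g y = \<theta> *\<^sub>R (x - y)" for x y
      by (simp add: scaleR_diff_right)
    then show ?thesis
      using assms by (simp only: inner_scaleR_left times_divide_eq_left pos_divide_le_eq mult.commute)
  qed
  finally show ?thesis
    using assms
    by (simp only: cocoercive_def strengthening_inner_perturbation_apply zero_less_divide_iff) simp
qed

text \<open>The defining inequality is an equality here: both sides are c times the squared norm of
  x - y.\<close>

lemma cocoercive_scaleR_id:
  assumes "c > 0"
  shows "cocoercive (inverse c) (\<lambda>x::'a::real_inner. c *\<^sub>R x)"
proof -
  have "(x - y) \<bullet> (c *\<^sub>R x - c *\<^sub>R y) = c * ((x - y) \<bullet> (x - y))" for x y :: 'a
    by (metis inner_scaleR_right scaleR_diff_right)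
  moreover have "(norm (c *\<^sub>R x - c *\<^sub>R y))\<^sup>2 = c * (c * ((x - y) \<bullet> (x - y)))" for x y :: 'a
    by (metis inner_scaleR_left inner_scaleR_right power2_norm_eq_inner scaleR_diff_right)
  ultimately show ?thesis
    using assms by (simp add: cocoercive_def flip: mult.assoc)
qed

text \<open>The factor on the left is the parallel sum ab / (a + b). After multiplication by a + b,
  the gap between the two sides is a perfect square.\<close>

lemma norm_add_power2_le:
  fixes u v :: "'a::real_inner"
  assumes "a > 0" and "b > 0"
  shows "inverse (inverse a + inverse b) * (norm (u + v))\<^sup>2 \<le> a * (norm u)\<^sup>2 + b * (norm v)\<^sup>2"
proof -
  have "(a + b) * (a * (norm u)\<^sup>2 + b * (norm v)\<^sup>2) - a * b * (norm (u + v))\<^sup>2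
      = (norm (a *\<^sub>R u - b *\<^sub>R v))\<^sup>2"
    unfolding power2_norm_eq_inner
    by (simp add: inner_commute algebra_simps power2_eq_square)
  then have "a * b * (norm (u + v))\<^sup>2 \<le> (a + b) * (a * (norm u)\<^sup>2 + b * (norm v)\<^sup>2)"
    by (metis diff_ge_0_iff_ge zero_le_power2)
  moreover have "inverse (inverse a + inverse b) = a * b / (a + b)"
    using assms by (simp add: field_simps)
  ultimately show ?thesis
    using assms by (simp add: pos_divide_le_eq mult.commute)
qed

lemma cocoercive_add:
  assumes S: "cocoercive a S" and T: "cocoercive b T"
  shows "cocoercive (inverse (inverse a + inverse b)) (\<lambda>x. S x + T x)"
proof -
  have ab: "a > 0" "b > 0"
    using S T by (auto simp: cocoercive_def)
  show ?thesis
    unfolding cocoercive_def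
  proof (intro conjI allI)
    show "0 < inverse (inverse a + inverse b)"
      using ab by (simp add: add_pos_pos)
    fix x y
    \<comment> \<open>The norm inequality is applied to the increments of S and T, whose weighted
      squares are bounded by cocoercivity.\<close>
    have "inverse (inverse a + inverse b) * (norm ((S x - S y) + (T x - T y)))\<^sup>2
        \<le> a * (norm (S x - S y))\<^sup>2 + b * (norm (T x - T y))\<^sup>2"
      by (rule norm_add_power2_le[OF ab])
    also have "\<dots> \<le> (x - y) \<bullet> (S x - S y) + (x - y) \<bullet> (T x - T y)"
      using S T unfolding cocoercive_def by (intro add_mono) auto
    finally show "inverse (inverse a + inverse b) * (norm (S x + T x - (S y + T y)))\<^sup>2
        \<le> (x - y) \<bullet> (S x + T x - (S y + T y))"
      by (simp add: add_diff_add inner_add_right)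
  qed
qed

lemma cocoercive_strengthening:
  fixes B :: "'a::real_inner \<Rightarrow> 'a"
  assumes "\<theta> > 0" and "cocoercive \<beta> B" and "\<sigma> > 0"
  shows "cocoercive (inverse (\<theta> / \<beta> + \<sigma>)) (strengthening \<theta> \<sigma> (inner_perturbation w B))"
proof -
  have "cocoercive (\<beta> / \<theta>) (strengthening \<theta> 0 (inner_perturbation w B))"
    using assms cocoercive_strengthening_iff by blast
  \<comment> \<open>The constants \<open>\<beta> / \<theta>\<close> and
    \<open>inverse \<sigma>\<close> have reciprocals \<open>\<theta> / \<beta>\<close> and
    \<open>\<sigma>\<close>, which add up to the reciprocal of the claimed constant.\<close>
  from cocoercive_add[OF this cocoercive_scaleR_id[OF \<open>\<sigma> > 0\<close>]] show ?thesis
    by (subst strengthening_conv_add) simp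
qed

theorem theorem1:
  fixes B :: "'h::{real_inner, complete_space} \<Rightarrow> 'h"
    and q :: 'h
    and \<theta> \<sigma> \<kappa> \<beta> :: real
  assumes "\<theta> > 0" and "\<kappa> > 0" and "\<beta> > 0"
  shows
    "(\<kappa>-lipschitz_on UNIV B \<longleftrightarrow>
        (\<kappa> * \<theta>)-lipschitz_on UNIV (strengthening \<theta> 0 (inner_perturbation (- q) B)))
     \<and> (\<kappa>-lipschitz_on UNIV B \<longrightarrow>
        (\<kappa> * \<theta> + \<bar>\<sigma>\<bar>)-lipschitz_on UNIV (strengthening \<theta> \<sigma> (inner_perturbation (- q) B)))
     \<and> (locally_lipschitz B \<longleftrightarrow>
        locally_lipschitz (strengthening \<theta> \<sigma> (inner_perturbation (- q) B)))
     \<and> (cocoercive \<beta> B \<longleftrightarrow>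
        cocoercive (\<beta> / \<theta>) (strengthening \<theta> 0 (inner_perturbation (- q) B)))
     \<and> (cocoercive \<beta> B \<and> \<sigma> > 0 \<longrightarrow>
        cocoercive (inverse (\<theta> / \<beta> + \<sigma>)) (strengthening \<theta> \<sigma> (inner_perturbation (- q) B)))"
proof -
  have "\<theta> \<noteq> 0" "\<theta> \<ge> 0"
    using assms(1) by auto
  show ?thesis
    apply (intro conjI impI)
    subgoal by (rule lipschitz_on_strengthening_iff[OF assms(1)])
    subgoal using \<open>\<theta> \<ge> 0\<close> by (rule lipschitz_on_strengthening[rotated])
    subgoal by (rule locally_lipschitz_strengthening_iff[OF \<open>\<theta> \<noteq> 0\<close>])
    subgoal by (rule cocoercive_strengthening_iff[OF assms(1)])
    subgoal by (elim conjE) (rule cocoercive_strengthening[OF assms(1)])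
    done
qed

end
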